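(* Let $\lVert\cdot\rVert_A$ and $\lVert\cdot\rVert_B$ be rearrangement-invariant quasi-Banach function norms over $([0,\infty),\lambda)$. Then the Wiener--Luxemburg quasinorm $\lVert\cdot\rVert_{WL(A,B)}$ is a rearrangement-invariant quasi-Banach function norm. Consequently, the corresponding Wiener--Luxemburg amalgam $WL(A,B)$ is a rearrangement-invariant quasi-Banach function space. Moreover, $\lVert\cdot\rVert_{WL(A,B)}$ has the property (P5) if and only if $\lVert\cdot\rVert_A$ does.
   Context: $\lambda$ is Lebesgue measure on $[0,\infty)$; $M$ is the set of extended complex-valued $\lambda$-measurable functions on $[0,\infty)$ (identified when equal a.e.), $M_+$ the non-negative ones. The non-increasing rearrangement of $f\in M$ is $f^*(t)=\inf\{s\ge 0:\lambda(\{|f|>s\})\le t\}$. A quasi-Banach function norm is a map $\lVert\cdot\rVert:M\to[0,\infty]$ with $\lVert\,|f|\,\rVert=\lVert f\rVert$ whose restriction to $M_+$ satisfies: (Q1) it is positively homogeneous, $\lVert f\rVert=0\Leftrightarrow f=0$ a.e., and there is a constant $C\ge1$ with $\lVert f+g\rVert\le C(\lVert f\rVert+\lVert g\rVert)$; (P2) $f\le g$ a.e. implies $\lVert f\rVert\le\lVert g\rVert$; (P3) $f_n\uparrow f$ a.e. implies $\lVert f_n\rVert\uparrow\lVert f\rVert$; (P4) $\lVert\chi_E\rVert<\infty$ whenever $\lambda(E)<\infty$. Property (P5): for every $E$ with $\lambda(E)<\infty$ there is a finite $C_E$ with $\int_E f\,d\lambda\le C_E\lVert f\rVert$ for all $f\in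 M_+$. The norm is rearrangement-invariant (r.i.) if $f^*=g^*$ implies $\lVert f\rVert=\lVert g\rVert$. The corresponding (r.i.) quasi-Banach function space is $X=\{f\in M:\lVert f\rVert_X<\infty\}$. For r.i. quasi-Banach function norms: $\lVert f\rVert_{WL(A,B)}=\lVert f^*\chi_{[0,1]}\rVert_A+\lVert f^*\chi_{(1,\infty)}\rVert_B$ for $f\in M$, and $WL(A,B)=\{f\in M:\lVert f\rVert_{WL(A,B)}<\infty\}$. *)

theory Defs
  imports "HOL-Analysis.Analysis"
begin

text \<open>
  Extended complex numbers are the one-point compactification of the complex plane, with
  \<open>None\<close> as the point at infinity. No arithmetic is defined on them: addition, scaling and
  ordering are only needed for non-negative functions, which take values in \<^typ>\<open>ennreal\<close>.
\<close>

type_synonym ecomplex = "complex option"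

definition ecomplex_borel :: "ecomplex measure" where
  "ecomplex_borel =
     sigma UNIV {U. openin (Alexandroff_compactification (euclidean :: complex topology)) U}"

definition emod :: "ecomplex \<Rightarrow> ennreal" where
  "emod z = (case z of None \<Rightarrow> \<infinity> | Some w \<Rightarrow> ennreal (cmod w))"

definition ecomplex_of_ennreal :: "ennreal \<Rightarrow> ecomplex" where
  "ecomplex_of_ennreal x = (if x = \<infinity> then None else Some (complex_of_real (enn2real x)))"

abbreviation leb :: "real measure" where
  "leb \<equiv> lebesgue_on {0..}"

text \<open>
  The elements of \<open>Mfun\<close> and \<open>Mplus\<close> are representatives of the classes modulo equality almost
  everywhere; their values on the negative half-line are irrelevant.
\<close>

definition Mfun :: "(real \<Rightarrow> ecomplex) set" where
  "Mfun = measurable leb ecomplex_borel"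

definition Mplus :: "(real \<Rightarrow> ennreal) set" where
  "Mplus = borel_measurable leb"

definition emb :: "(real \<Rightarrow> ennreal) \<Rightarrow> real \<Rightarrow> ecomplex" where
  "emb g = (\<lambda>x. ecomplex_of_ennreal (g x))"

definition rearr :: "(real \<Rightarrow> ecomplex) \<Rightarrow> real \<Rightarrow> ennreal" where
  "rearr f t = Inf {s. s < \<infinity> \<and> emeasure leb {x \<in> {0..}. s < emod (f x)} \<le> ennreal t}"

type_synonym fnorm = "(real \<Rightarrow> ecomplex) \<Rightarrow> ennreal"

definition restr :: "fnorm \<Rightarrow> (real \<Rightarrow> ennreal) \<Rightarrow> ennreal" where
  "restr N g = N (emb g)"

definition norm_Q1 :: "fnorm \<Rightarrow> bool" where
  "norm_Q1 N \<longleftrightarrow>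
     (\<forall>c::real. \<forall>f\<in>Mplus. 0 \<le> c \<longrightarrow> restr N (\<lambda>x. ennreal c * f x) = ennreal c * restr N f) \<and>
     (\<forall>f\<in>Mplus. restr N f = 0 \<longleftrightarrow> (AE x in leb. f x = 0)) \<and>
     (\<exists>C::real. 1 \<le> C \<and>
        (\<forall>f\<in>Mplus. \<forall>g\<in>Mplus. restr N (\<lambda>x. f x + g x) \<le> ennreal C * (restr N f + restr N g)))"

definition norm_P2 :: "fnorm \<Rightarrow> bool" where
  "norm_P2 N \<longleftrightarrow>
     (\<forall>f\<in>Mplus. \<forall>g\<in>Mplus. (AE x in leb. f x \<le> g x) \<longrightarrow> restr N f \<le> restr N g)"

definition norm_P3 :: "fnorm \<Rightarrow> bool" where
  "norm_P3 N \<longleftrightarrow>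
     (\<forall>F f. (\<forall>n::nat. F n \<in> Mplus) \<and> f \<in> Mplus \<and>
        (AE x in leb. incseq (\<lambda>n. F n x) \<and> (\<lambda>n. F n x) \<longlonglongrightarrow> f x) \<longrightarrow>
        incseq (\<lambda>n. restr N (F n)) \<and> (\<lambda>n. restr N (F n)) \<longlonglongrightarrow> restr N f)"

definition norm_P4 :: "fnorm \<Rightarrow> bool" where
  "norm_P4 N \<longleftrightarrow>
     (\<forall>E\<in>sets leb. emeasure leb E < \<infinity> \<longrightarrow> restr N (indicator E) < \<infinity>)"

definition norm_P5 :: "fnorm \<Rightarrow> bool" where
  "norm_P5 N \<longleftrightarrow>
     (\<forall>E\<in>sets leb. emeasure leb E < \<infinity> \<longrightarrow>
        (\<exists>C::ennreal. C < \<infinity> \<and>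
           (\<forall>f\<in>Mplus. (\<integral>\<^sup>+x\<in>E. f x \<partial>leb) \<le> C * restr N f)))"

text \<open>
  The first conjunct says that the norm is well defined on the classes modulo equality almost
  everywhere.
\<close>

definition quasi_Banach_function_norm :: "fnorm \<Rightarrow> bool" where
  "quasi_Banach_function_norm N \<longleftrightarrow>
     (\<forall>f\<in>Mfun. \<forall>g\<in>Mfun. (AE x in leb. f x = g x) \<longrightarrow> N f = N g) \<and>
     (\<forall>f\<in>Mfun. N (emb (\<lambda>x. emod (f x))) = N f) \<and>
     norm_Q1 N \<and> norm_P2 N \<and> norm_P3 N \<and> norm_P4 N"

definition rearrangement_invariant :: "fnorm \<Rightarrow> bool" where
  "rearrangement_invariant N \<longleftrightarrow>
     (\<forall>f\<in>Mfun. \<forall>g\<in>Mfun. (\<forall>t\<ge>0. rearr f t = rearr g t) \<longrightarrow> N f = N g)"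

definition ri_quasi_Banach_function_norm :: "fnorm \<Rightarrow> bool" where
  "ri_quasi_Banach_function_norm N \<longleftrightarrow>
     quasi_Banach_function_norm N \<and> rearrangement_invariant N"

definition fun_space :: "fnorm \<Rightarrow> (real \<Rightarrow> ecomplex) set" where
  "fun_space N = {f \<in> Mfun. N f < \<infinity>}"

definition ri_quasi_Banach_function_space :: "(real \<Rightarrow> ecomplex) set \<Rightarrow> bool" where
  "ri_quasi_Banach_function_space X \<longleftrightarrow>
     (\<exists>N. ri_quasi_Banach_function_norm N \<and> X = fun_space N)"

definition WL_norm :: "fnorm \<Rightarrow> fnorm \<Rightarrow> fnorm" where
  "WL_norm A B f =
     A (emb (\<lambda>t. rearr f t * indicator {0..1} t)) +
     B (emb (\<lambda>t. rearr f t * indicator {1<..} t))"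

definition WL :: "fnorm \<Rightarrow> fnorm \<Rightarrow> (real \<Rightarrow> ecomplex) set" where
  "WL A B = {f \<in> Mfun. WL_norm A B f < \<infinity>}"

lemma emod_ecomplex_of_ennreal [simp]: "emod (ecomplex_of_ennreal x) = x"
  by (cases x) (auto simp: emod_def ecomplex_of_ennreal_def top_unique)

lemma measurable_ecomplex_of_ennreal: "ecomplex_of_ennreal \<in> measurable borel ecomplex_borel"
  unfolding ecomplex_borel_def
proof (rule measurable_measure_of)
  fix U :: "ecomplex set"
  assume "U \<in> {U. openin (Alexandroff_compactification (euclidean :: complex topology)) U}"
  then have "openin euclidean {w. Some w \<in> U}"
    using openin_continuous_map_preimage[OF continuous_map_Some, of "euclidean :: complex topology" U]
    by simp
  then have o: "open {w. Some w \<in> U}" by simp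
  have "(\<lambda>x. complex_of_real (enn2real x)) \<in> borel_measurable borel"
    by measurable
  from measurable_sets[OF this borel_open[OF o]]
  have m: "{x. Some (complex_of_real (enn2real x)) \<in> U} \<in> sets borel"
    by (simp add: vimage_def)
  have "ecomplex_of_ennreal -` U =
     ({x. Some (complex_of_real (enn2real x)) \<in> U} - {\<infinity>}) \<union> (if None \<in> U then {\<infinity>} else {})"
    by (auto simp: ecomplex_of_ennreal_def split: if_splits)
  then show "ecomplex_of_ennreal -` U \<inter> space borel \<in> sets borel"
    using m by auto
qed auto

lemma emb_in_Mfun: "g \<in> Mplus \<Longrightarrow> emb g \<in> Mfun"
  unfolding Mplus_def Mfun_def emb_def
  by (rule measurable_compose[OF _ measurable_ecomplex_of_ennreal])

lemma measurable_emod: "emod \<in> measurable ecomplex_borel borel"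
proof (rule borel_measurableI_less)
  fix y :: ennreal
  have sp: "space ecomplex_borel = UNIV" by (simp add: ecomplex_borel_def)
  have "openin (Alexandroff_compactification euclidean) (Some ` {w::complex. ennreal (cmod w) < y})"
  proof -
    have "open {w::complex. ennreal (cmod w) < y}"
      by (intro open_Collect_less continuous_on_ennreal continuous_intros)
    then show ?thesis unfolding openin_Alexandroff_compactification by auto
  qed
  then have "Some ` {w::complex. ennreal (cmod w) < y} \<in> sets ecomplex_borel"
    by (auto simp: ecomplex_borel_def)
  also have "Some ` {w::complex. ennreal (cmod w) < y} = {z. emod z < y}"
    by (auto simp: emod_def image_iff split: option.splits)
  finally show "{x \<in> space ecomplex_borel. emod x < y} \<in> sets ecomplex_borel"
    by (simp add: sp)
qed

end

theory Submission
  imports Defs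
begin

text \<open>
  The equivalence \<open>s < f\<^sup>*(t) \<longleftrightarrow> t < \<lambda>{f > s}\<close> turns rearrangement invariance into monotonicity
  of the norm with respect to distribution functions. Every \<open>f \<ge> 0\<close> splits at the level \<open>f\<^sup>*(1)\<close>
  into a peak, supported on a set of measure at most \<open>1\<close> and controlled by \<open>f\<^sup>*\<chi>\<^bsub>[0,1]\<^esub>\<close> in \<open>A\<close>,
  and a truncation controlled by \<open>f\<^sup>*(1)\<close> and by \<open>f\<^sup>*\<chi>\<^bsub>(1,\<infinity>)\<^esub>\<close> in \<open>B\<close>, while \<open>f\<^sup>*(1)\<close> itself is at
  most a constant times the \<open>A\<close>-norm of \<open>f\<^sup>*\<chi>\<^bsub>[0,1]\<^esub>\<close>. This splitting gives the triangle inequality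
  without dilation operators, and the equivalence of (P5) without the Hardy--Littlewood inequality.
\<close>

section \<open>Distribution functions and rearrangements\<close>

definition distrib :: "(real \<Rightarrow> ennreal) \<Rightarrow> ennreal \<Rightarrow> ennreal" where
  "distrib g s = emeasure leb {x \<in> {0..}. s < g x}"

text \<open>The rearrangement for \<open>ennreal\<close>-valued functions; \<open>rearr\<close> of a
  function is \<open>star\<close> of its modulus, so extended complex values disappear from the
  estimates.\<close>

definition star :: "(real \<Rightarrow> ennreal) \<Rightarrow> real \<Rightarrow> ennreal" where
  "star g t = Inf {s. s < \<infinity> \<and> distrib g s \<le> ennreal t}"

lemma rearr_eq_star: "rearr f = star (\<lambda>x. emod (f x))"
  by (simp add: rearr_def star_def distrib_def fun_eq_iff)

lemma rearr_emb [simp]: "rearr (emb g) = star g"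
  by (simp add: rearr_eq_star emb_def)

section \<open>Measurability of superlevel sets and monotonicity of the distribution
  function\<close>

lemma space_leb [simp]: "space leb = {0..}"
  by (simp add: space_restrict_space)

lemma emeasure_leb: "S \<in> sets borel \<Longrightarrow> S \<subseteq> {0..} \<Longrightarrow> emeasure leb S = emeasure lborel S"
  by (subst emeasure_restrict_space) auto

lemma ident_measurable_leb [measurable]: "(\<lambda>x. x) \<in> borel_measurable leb"
proof (rule measurable_restrict_space1)
  show "(\<lambda>x::real. x) \<in> borel_measurable lebesgue"
    by (rule measurable_completion) simp
qed

lemma sets_level [measurable]:
  fixes g :: "real \<Rightarrow> ennreal"
  assumes [measurable]: "g \<in> borel_measurable leb"
  shows "{x \<in> {0..}. s < g x} \<in> sets leb"
proof -
  have "{x \<in> space leb. s < g x} \<in> sets leb"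
    by measurable
  then show ?thesis by simp
qed

lemma distrib_mono_AE:
  assumes [measurable]: "f \<in> borel_measurable leb" "g \<in> borel_measurable leb"
    and "AE x in leb. f x \<le> g x"
  shows "distrib f s \<le> distrib g s"
  unfolding distrib_def
proof (rule emeasure_mono_AE)
  show "AE x in leb. x \<in> {x \<in> {0..}. s < f x} \<longrightarrow> x \<in> {x \<in> {0..}. s < g x}"
    using assms(3) by eventually_elim auto
qed measurable

lemma distrib_antimono:
  assumes [measurable]: "g \<in> borel_measurable leb" and "s \<le> s'"
  shows "distrib g s' \<le> distrib g s"
  unfolding distrib_def
  by (rule emeasure_mono[OF _ sets_level]) (use assms(2) in auto)

lemma distrib_top [simp]: "distrib g top = 0"
  by (simp add: distrib_def)

text \<open>The sets where \<open>g\<close> exceeds \<open>s + 1/(n+1)\<close> increase to the set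
  where \<open>g\<close> exceeds \<open>s\<close>, so continuity of the measure from below
  applies.\<close>

lemma distrib_right_continuous:
  assumes [measurable]: "g \<in> borel_measurable leb" and t: "t < distrib g s"
  shows "\<exists>s'>s. t < distrib g s'"
proof -
  \<comment> \<open>Only above a finite \<open>s\<close> is \<open>s + 1/(n+1)\<close> strictly
    larger.\<close>
  have s: "s < top"
    using t by (metis distrib_top not_less_zero top.not_eq_extremum)
  let ?e = "\<lambda>n. s + ennreal (1 / real (Suc n))"
  have lt: "s < ?e n" for n
    using s ennreal_add_left_cancel_less[of s 0 "ennreal (1 / real (Suc n))"]
    by (auto simp: less_top)
  have dec: "?e n \<le> ?e m" if "m \<le> n" for m n
    using that by (intro add_left_mono ennreal_leI) (simp add: frac_le)
  have lim: "?e \<longlonglongrightarrow> s"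
  proof -
    have "(\<lambda>n. ennreal (1 / real (Suc n))) \<longlonglongrightarrow> ennreal 0"
      by (intro tendsto_ennrealI LIMSEQ_Suc lim_1_over_n)
    then have "?e \<longlonglongrightarrow> s + ennreal 0"
      by (intro tendsto_add tendsto_const)
    then show ?thesis by simp
  qed
  have eq: "{x \<in> {0..}. s < g x} = (\<Union>n. {x \<in> {0..}. ?e n < g x})"
  proof (intro equalityI subsetI)
    fix x assume x: "x \<in> {x \<in> {0..}. s < g x}"
    then have "eventually (\<lambda>n. ?e n < g x) sequentially"
      by (intro order_tendstoD(2)[OF lim]) auto
    then show "x \<in> (\<Union>n. {x \<in> {0..}. ?e n < g x})"
      using x by (auto dest: eventually_happens'[OF sequentially_bot])
  next
    fix x assume "x \<in> (\<Union>n. {x \<in> {0..}. ?e n < g x})"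
    then show "x \<in> {x \<in> {0..}. s < g x}"
      using less_trans[OF lt] by blast
  qed
  have "distrib g s = (SUP n. distrib g (?e n))"
    unfolding distrib_def eq
  proof (rule SUP_emeasure_incseq[symmetric])
    show "range (\<lambda>n. {x \<in> {0..}. ?e n < g x}) \<subseteq> sets leb"
      by (blast intro: sets_level assms)
    show "incseq (\<lambda>n. {x \<in> {0..}. ?e n < g x})"
      unfolding incseq_def using le_less_trans[OF dec] by blast
  qed
  with t obtain n where "t < distrib g (?e n)"
    by (auto simp: less_SUP_iff)
  with lt show ?thesis by blast
qed

text \<open>One direction is the definition of the infimum. The converse needs right continuity,
  since an infimum of levels that all exceed \<open>s\<close> could still equal
  \<open>s\<close>.\<close>

lemma less_star_iff:
  assumes [measurable]: "g \<in> borel_measurable leb"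
  shows "s < star g t \<longleftrightarrow> ennreal t < distrib g s"
proof
  assume "s < star g t"
  show "ennreal t < distrib g s"
  proof (rule ccontr)
    assume "\<not> ennreal t < distrib g s"
    moreover have "s < \<infinity>"
      using \<open>s < star g t\<close> by (simp add: less_top[symmetric]) auto
    ultimately have "star g t \<le> s"
      unfolding star_def by (intro Inf_lower) auto
    with \<open>s < star g t\<close> show False by simp
  qed
next
  assume "ennreal t < distrib g s"
  then obtain s' where s': "s < s'" "ennreal t < distrib g s'"
    using distrib_right_continuous[OF assms] by blast
  have "s' \<le> star g t"
    unfolding star_def
  proof (rule Inf_greatest)
    fix r assume "r \<in> {s. s < \<infinity> \<and> distrib g s \<le> ennreal t}"
    then have "distrib g r < distrib g s'"
      using s' by auto
    then show "s' \<le> r"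
      using distrib_antimono[OF assms, of r s'] by (meson leD linear)
  qed
  with s' show "s < star g t" by simp
qed

text \<open>The set is the interval \<open>[0,d)\<close>. For \<open>d = distrib g s\<close> it is
  the superlevel set of \<open>star g\<close>, which makes \<open>g\<close> and
  \<open>star g\<close> equimeasurable.\<close>

lemma emeasure_leb_less: "emeasure leb {t \<in> {0..}. ennreal t < d} = d"
proof (cases d)
  case (real r)
  then have "{t \<in> {0..}. ennreal t < d} = {0..<r}"
    by (auto simp: ennreal_less_iff)
  moreover have "emeasure leb {0..<r} = emeasure lborel {0..<r}"
    by (rule emeasure_leb) auto
  ultimately show ?thesis using real by simp
next
  case top
  then have "{t \<in> {0..}. ennreal t < d} = {0..}" by auto
  moreover have "emeasure lborel {0::real..} = top"
  proof (rule ccontr)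
    assume "emeasure lborel {0::real..} \<noteq> top"
    then obtain n where "emeasure lborel {0::real..} < of_nat n"
      using ennreal_Ex_less_of_nat by (auto simp: less_top)
    moreover have "emeasure lborel {0..real n} \<le> emeasure lborel {0::real..}"
      by (rule emeasure_mono) auto
    ultimately show False
      by (simp add: ennreal_of_nat_eq_real_of_nat)
  qed
  ultimately show ?thesis using top by (simp add: emeasure_leb)
qed

lemma star_measurable [measurable]:
  assumes "g \<in> borel_measurable leb"
  shows "star g \<in> borel_measurable leb"
proof (rule borel_measurableI_greater)
  fix s
  have "{t \<in> space leb. ennreal t < distrib g s} \<in> sets leb"
    by measurable
  then show "{t \<in> space leb. s < star g t} \<in> sets leb"
    by (simp only: less_star_iff[OF assms])
qed

lemma distrib_star [simp]:
  assumes "g \<in> borel_measurable leb"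
  shows "distrib (star g) s = distrib g s"
  unfolding distrib_def[of "star g"] less_star_iff[OF assms] by (rule emeasure_leb_less)

section \<open>Order properties of the rearrangement and of its restrictions to intervals\<close>

lemma star_mono:
  assumes "f \<in> borel_measurable leb" "g \<in> borel_measurable leb"
    and "\<And>s. distrib f s \<le> distrib g s"
  shows "star f t \<le> star g t"
proof (rule ccontr)
  assume "\<not> star f t \<le> star g t"
  then have "star g t < star f t" by simp
  then have "ennreal t < distrib f (star g t)"
    using less_star_iff[OF assms(1)] by blast
  also have "\<dots> \<le> distrib g (star g t)" by (rule assms(3))
  finally show False using less_star_iff[OF assms(2)] by blast
qed

lemma star_antimono:
  assumes "g \<in> borel_measurable leb" "t \<le> t'"
  shows "star g t' \<le> star g t"
  unfolding star_def using assms(2)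
  by (intro Inf_superset_mono) (auto intro: order_trans ennreal_leI)

lemma star_cong_distrib:
  "(\<And>s. distrib f s = distrib g s) \<Longrightarrow> star f = star g"
  by (simp add: star_def fun_eq_iff)

text \<open>The superlevel set of \<open>star g\<close> is \<open>[0, distrib g s)\<close>, so its
  part in \<open>[0,1]\<close> contains \<open>[0, min 1 (distrib g s))\<close>.\<close>

lemma distrib_head_ge:
  assumes "g \<in> borel_measurable leb"
  shows "min 1 (distrib g s) \<le> distrib (\<lambda>t. star g t * indicator {0..1} t) s"
proof -
  have "min 1 (distrib g s) = emeasure leb {t \<in> {0..}. ennreal t < min 1 (distrib g s)}"
    by (rule emeasure_leb_less[symmetric])
  also have "\<dots> \<le> distrib (\<lambda>t. star g t * indicator {0..1} t) s"
    unfolding distrib_def[of "\<lambda>t. star g t * _ t"]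
  proof (rule emeasure_mono[OF _ sets_level])
    show "{t \<in> {0..}. ennreal t < min 1 (distrib g s)} \<subseteq>
        {t \<in> {0..}. s < star g t * indicator {0..1} t}"
      using less_star_iff[OF assms]
      by (auto simp: indicator_def ennreal_less_one_iff)
    have [measurable]: "g \<in> borel_measurable leb" by fact
    show "(\<lambda>t. star g t * indicator {0..1} t) \<in> borel_measurable leb"
      by measurable
  qed
  finally show ?thesis .
qed

text \<open>Beyond \<open>a\<close> the superlevel set lies between \<open>a\<close> and
  \<open>distrib g s\<close>; the truncated subtraction of \<open>ennreal\<close> covers the case
  where nothing is left.\<close>

lemma distrib_tail_le:
  assumes g: "g \<in> borel_measurable leb" and "0 \<le> a"
  shows "distrib (\<lambda>t. star g t * indicator {a<..} t) s \<le> distrib g s - ennreal a"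
proof -
  have "{t \<in> {0..}. s < star g t * indicator {a<..} t} \<subseteq> {t \<in> {0..}. a < t \<and> ennreal t < distrib g s}"
    using less_star_iff[OF g] by (auto simp: indicator_def)
  moreover have "{t \<in> {0..}. a < t \<and> ennreal t < distrib g s} \<in> sets leb"
  proof -
    have "{t \<in> space leb. a < t \<and> ennreal t < distrib g s} \<in> sets leb" by measurable
    then show ?thesis by simp
  qed
  ultimately have "distrib (\<lambda>t. star g t * indicator {a<..} t) s \<le>
      emeasure leb {t \<in> {0..}. a < t \<and> ennreal t < distrib g s}"
    unfolding distrib_def[of "\<lambda>t. star g t * _ t"] by (rule emeasure_mono)
  also have "\<dots> \<le> distrib g s - ennreal a"
  proof (cases "distrib g s")
    case (real r)
    then have "{t \<in> {0..}. a < t \<and> ennreal t < distrib g s} = {a<..<r}"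
      using \<open>0 \<le> a\<close> by (auto simp: ennreal_less_iff)
    moreover have "emeasure leb {a<..<r} = emeasure lborel {a<..<r}"
      using \<open>0 \<le> a\<close> by (intro emeasure_leb) auto
    moreover have "emeasure lborel {a<..<r} \<le> ennreal (r - a)"
      by (cases "a \<le> r") auto
    ultimately show ?thesis using real \<open>0 \<le> a\<close>
      by (simp only: ennreal_minus)
  qed simp
  finally show ?thesis .
qed

lemma distrib_min:
  "distrib (\<lambda>x. min (f x) c) s = (if s < c then distrib f s else 0)"
  by (auto simp: distrib_def)

lemma distrib_star_le:
  assumes [measurable]: "f \<in> borel_measurable leb" "E \<in> sets borel"
  shows "distrib (\<lambda>t. star f t * indicator E t) s \<le> distrib f s"
proof -
  have "distrib (\<lambda>t. star f t * indicator E t) s \<le> distrib (star f) s"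
  proof (rule distrib_mono_AE)
    show "AE t in leb. star f t * indicator E t \<le> star f t"
      by (auto split: split_indicator)
  qed measurable
  then show ?thesis by simp
qed

text \<open>For finite \<open>c\<close> the superlevel set of \<open>u + c\<close> at level
  \<open>star u t + c\<close> is that of \<open>u\<close> at level \<open>star u t\<close>, whose
  measure is at most \<open>ennreal t\<close>. An infinite \<open>c\<close> makes the bound
  trivial.\<close>

lemma star_add_const_le:
  assumes [measurable]: "u \<in> borel_measurable leb"
  shows "star (\<lambda>x. u x + c) t \<le> star u t + c"
proof (rule ccontr)
  define s where "s = star u t + c"
  assume "\<not> star (\<lambda>x. u x + c) t \<le> star u t + c"
  then have less: "s < star (\<lambda>x. u x + c) t" by (simp add: s_def)
  then have "s \<noteq> top" using less_top by fastforce
  then have "c \<noteq> top" by (auto simp: s_def)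
  have "ennreal t < distrib (\<lambda>x. u x + c) s"
    using less by (subst (asm) less_star_iff) auto
  also have "\<dots> = distrib u (star u t)"
    using \<open>c \<noteq> top\<close>
    by (simp add: distrib_def s_def ennreal_add_left_cancel_less add.commute[of _ c] less_top)
  finally show False
    using less_star_iff[of u "star u t" t] by simp
qed

lemma star_cmult:
  assumes [measurable]: "f \<in> borel_measurable leb" and "0 \<le> c"
  shows "star (\<lambda>x. ennreal c * f x) = (\<lambda>t. ennreal c * star f t)"
proof (cases "c = 0")
  case True
  have "star (\<lambda>x. 0) t = 0" for t
    using less_star_iff[of "\<lambda>x. 0" 0 t] by (auto simp: distrib_def)
  then show ?thesis using True by (simp add: fun_eq_iff)
next
  case False
  with \<open>0 \<le> c\<close> have c: "0 < ennreal c" "ennreal c < top" by auto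
  have *: "s < ennreal c * y \<longleftrightarrow> s / ennreal c < y" for s y
    using c by (auto simp: divide_less_ennreal mult.commute)
  have "s < star (\<lambda>x. ennreal c * f x) t \<longleftrightarrow> s < ennreal c * star f t" for s t
    by (subst less_star_iff) (auto simp: * less_star_iff distrib_def)
  then show ?thesis
    by (metis (no_types, lifting) ext less_irrefl linorder_neqE)
qed

text \<open>Superlevel sets at a fixed level grow, up to null sets, to that of the limit, so
  distribution functions converge from below; \<open>less_star_iff\<close> carries the supremum over
  to the rearrangements, at every \<open>t\<close>.\<close>

lemma star_SUP:
  assumes [measurable]: "\<And>n. F n \<in> borel_measurable leb" "f \<in> borel_measurable leb"
    and conv: "AE x in leb. incseq (\<lambda>n. F n x) \<and> (\<lambda>n. F n x) \<longlonglongrightarrow> f x"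
  shows "incseq (\<lambda>n. star (F n) t)" "(\<lambda>n. star (F n) t) \<longlonglongrightarrow> star f t"
proof -
  have sup: "AE x in leb. incseq (\<lambda>n. F n x) \<and> f x = (SUP n. F n x)"
    using conv by eventually_elim (auto intro: LIMSEQ_unique LIMSEQ_SUP)
  have dmono: "distrib (F m) s \<le> distrib (F n) s" if "m \<le> n" for m n s
    using conv by (intro distrib_mono_AE) (auto elim!: eventually_mono simp: incseq_def that)
  show inc: "incseq (\<lambda>n. star (F n) t)"
    by (auto simp: incseq_def intro!: star_mono dmono)
  have dsup: "distrib f s = (SUP n. distrib (F n) s)" for s
  proof -
    \<comment> \<open>The union over \<open>m \<le> n\<close> is increasing everywhere, although
      \<open>F\<close> is increasing only almost everywhere; it differs from the superlevel set of
      \<open>F n\<close> by a null set.\<close>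
    define G where "G n = {x \<in> {0..}. \<exists>m\<le>n. s < F m x}" for n
    have [measurable]: "G n \<in> sets leb" for n
    proof -
      have "{x \<in> space leb. \<exists>m\<le>n. s < F m x} \<in> sets leb" by measurable
      then show ?thesis by (simp add: G_def)
    qed
    have "distrib f s = emeasure leb (\<Union>n. G n)"
      unfolding distrib_def
    proof (rule emeasure_eq_AE)
      show "AE x in leb. x \<in> {x \<in> {0..}. s < f x} \<longleftrightarrow> x \<in> (\<Union>n. G n)"
        using sup by eventually_elim (auto simp: G_def less_SUP_iff)
    qed measurable
    also have "\<dots> = (SUP n. emeasure leb (G n))"
    proof (rule SUP_emeasure_incseq[symmetric])
      show "incseq G" unfolding incseq_def G_def by (blast intro: order_trans)
    qed auto
    also have "(\<lambda>n. emeasure leb (G n)) = (\<lambda>n. distrib (F n) s)"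
      unfolding distrib_def
    proof (intro ext, rule emeasure_eq_AE)
      fix n
      show "AE x in leb. x \<in> G n \<longleftrightarrow> x \<in> {x \<in> {0..}. s < F n x}"
        using sup
        by eventually_elim (auto simp: G_def incseq_def intro: less_le_trans)
    qed measurable
    finally show ?thesis .
  qed
  have "star f t = (SUP n. star (F n) t)"
  proof -
    have "s < star f t \<longleftrightarrow> s < (SUP n. star (F n) t)" for s
      by (simp add: less_star_iff less_SUP_iff dsup)
    then show ?thesis
      by (metis less_irrefl linorder_neqE)
  qed
  then show "(\<lambda>n. star (F n) t) \<longlonglongrightarrow> star f t"
    using LIMSEQ_SUP[OF inc] by simp
qed

section \<open>Heads and tails of rearrangements, and peaks of functions\<close>

definition head :: "(real \<Rightarrow> ennreal) \<Rightarrow> real \<Rightarrow> ennreal" where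
  "head f t = star f t * indicator {0..1} t"

definition tail :: "(real \<Rightarrow> ennreal) \<Rightarrow> real \<Rightarrow> ennreal" where
  "tail f t = star f t * indicator {1<..} t"

text \<open>Above the level the full value of \<open>f\<close> is kept and not the excess. This
  avoids subtraction in \<open>ennreal\<close>, and \<open>f \<le> peak f + star f 1\<close> still
  holds pointwise.\<close>

definition peak :: "(real \<Rightarrow> ennreal) \<Rightarrow> real \<Rightarrow> ennreal" where
  "peak f x = (if star f 1 < f x then f x else 0)"

lemma head_measurable [measurable]:
  assumes [measurable]: "f \<in> borel_measurable leb"
  shows "head f \<in> borel_measurable leb"
  unfolding head_def by measurable

lemma tail_measurable [measurable]:
  assumes [measurable]: "f \<in> borel_measurable leb"
  shows "tail f \<in> borel_measurable leb"
  unfolding tail_def by measurable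

lemma peak_measurable [measurable]:
  assumes [measurable]: "f \<in> borel_measurable leb"
  shows "peak f \<in> borel_measurable leb"
  unfolding peak_def by measurable

lemma distrib_head_le: "f \<in> borel_measurable leb \<Longrightarrow> distrib (head f) s \<le> distrib f s"
  unfolding head_def by (rule distrib_star_le) auto

lemma distrib_tail_le_distrib: "f \<in> borel_measurable leb \<Longrightarrow> distrib (tail f) s \<le> distrib f s"
  unfolding tail_def by (rule distrib_star_le) auto

lemma distrib_star_1: "f \<in> borel_measurable leb \<Longrightarrow> distrib f (star f 1) \<le> 1"
  using less_star_iff[of f "star f 1" 1] by simp

lemma distrib_peak_le:
  assumes [measurable]: "f \<in> borel_measurable leb"
  shows "distrib (peak f) s \<le> min 1 (distrib f s)"
proof -
  have "distrib (peak f) s \<le> distrib f (star f 1)"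
    unfolding distrib_def
    by (rule emeasure_mono[OF _ sets_level]) (auto simp: peak_def split: if_splits)
  moreover have "distrib (peak f) s \<le> distrib f s"
    unfolding distrib_def
    by (rule emeasure_mono[OF _ sets_level]) (auto simp: peak_def split: if_splits)
  ultimately show ?thesis
    using distrib_star_1[OF assms] by auto
qed

text \<open>The quantity \<open>min 1 (distrib f s)\<close> separates the two sides: it bounds the
  peak, which lives on a set of measure at most 1, and is bounded by the head.\<close>

lemma distrib_peak_le_head:
  assumes "f \<in> borel_measurable leb"
  shows "distrib (peak f) s \<le> distrib (head f) s"
  unfolding head_def
  by (rule order_trans[OF distrib_peak_le[OF assms] distrib_head_ge[OF assms]])

lemma tail_eq_0:
  assumes "f \<in> borel_measurable leb" and "\<And>s. distrib f s \<le> 1"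
  shows "tail f = (\<lambda>_. 0)"
proof
  fix t
  have "\<not> 0 < star f t" if "1 < t"
    unfolding less_star_iff[OF assms(1)]
    using order_trans[OF assms(2)[of 0], of "ennreal t"] that by (simp add: not_less)
  then show "tail f t = 0" by (auto simp: tail_def indicator_def)
qed

text \<open>Outside the sets where \<open>f\<close> exceeds \<open>star f 1\<close> or
  \<open>g\<close> exceeds \<open>star g 1\<close>, both minima are the functions themselves. Each
  of these sets has measure at most 1, whence the 2.\<close>

lemma distrib_add_le:
  assumes [measurable]: "f \<in> borel_measurable leb" "g \<in> borel_measurable leb"
  shows "distrib (\<lambda>x. f x + g x) s \<le>
    2 + distrib (\<lambda>x. min (f x) (star f 1) + min (g x) (star g 1)) s"
proof -
  let ?k = "\<lambda>x. min (f x) (star f 1) + min (g x) (star g 1)"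
  let ?S = "\<lambda>u r. {x \<in> {0..}. r < (u x :: ennreal)}"
  have "?S (\<lambda>x. f x + g x) s \<subseteq> ?S f (star f 1) \<union> ?S g (star g 1) \<union> ?S ?k s"
    by (auto simp: min_def not_less)
  then have "distrib (\<lambda>x. f x + g x) s \<le>
      emeasure leb (?S f (star f 1) \<union> ?S g (star g 1) \<union> ?S ?k s)"
    unfolding distrib_def by (rule emeasure_mono) measurable
  also have "\<dots> \<le> emeasure leb (?S f (star f 1) \<union> ?S g (star g 1)) + emeasure leb (?S ?k s)"
    by (rule emeasure_subadditive) measurable
  also have "\<dots> \<le> (emeasure leb (?S f (star f 1)) + emeasure leb (?S g (star g 1)))
      + emeasure leb (?S ?k s)"
    by (intro add_right_mono emeasure_subadditive) measurable
  also have "\<dots> \<le> (1 + 1) + distrib ?k s"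
    using distrib_star_1[OF assms(1)] distrib_star_1[OF assms(2)]
    unfolding distrib_def by (intro add_mono) auto
  finally show ?thesis by simp
qed

section \<open>Rearrangement-invariant quasi-Banach function norms\<close>

locale ri_norm =
  fixes N :: fnorm
  assumes ri: "ri_quasi_Banach_function_norm N"
begin

section \<open>The axioms for functions with values in \<open>ennreal\<close>\<close>

lemma mono:
  "f \<in> borel_measurable leb \<Longrightarrow> g \<in> borel_measurable leb \<Longrightarrow> AE x in leb. f x \<le> g x \<Longrightarrow>
    restr N f \<le> restr N g"
  using ri by (simp add: ri_quasi_Banach_function_norm_def quasi_Banach_function_norm_def
      norm_P2_def Mplus_def)

lemma mono_everywhere:
  assumes "f \<in> borel_measurable leb" "g \<in> borel_measurable leb" "\<And>x. 0 \<le> x \<Longrightarrow> f x \<le> g x"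
  shows "restr N f \<le> restr N g"
  using assms by (intro mono AE_I2) auto

lemma cmult_real:
  "f \<in> borel_measurable leb \<Longrightarrow> 0 \<le> c \<Longrightarrow> restr N (\<lambda>x. ennreal c * f x) = ennreal c * restr N f"
  using ri by (simp add: ri_quasi_Banach_function_norm_def quasi_Banach_function_norm_def
      norm_Q1_def Mplus_def)

lemma eq_0_iff:
  "f \<in> borel_measurable leb \<Longrightarrow> restr N f = 0 \<longleftrightarrow> (AE x in leb. f x = 0)"
  using ri by (simp add: ri_quasi_Banach_function_norm_def quasi_Banach_function_norm_def
      norm_Q1_def Mplus_def)

lemma triangle:
  obtains C :: ennreal where "C < top"
    "\<And>f g :: real \<Rightarrow> ennreal. f \<in> borel_measurable leb \<Longrightarrow> g \<in> borel_measurable leb \<Longrightarrow>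
      restr N (\<lambda>x. f x + g x) \<le> C * (restr N f + restr N g)"
proof -
  have "norm_Q1 N"
    using ri by (simp add: ri_quasi_Banach_function_norm_def quasi_Banach_function_norm_def)
  then obtain c :: real where "\<forall>f\<in>Mplus. \<forall>g\<in>Mplus.
      restr N (\<lambda>x. f x + g x) \<le> ennreal c * (restr N f + restr N g)"
    unfolding norm_Q1_def by (elim conjE exE) auto
  then show thesis
    by (intro that[of "ennreal c"]) (auto simp: Mplus_def)
qed

lemma monotone_convergence:
  assumes "\<And>n. F n \<in> borel_measurable leb" "f \<in> borel_measurable leb"
    "AE x in leb. incseq (\<lambda>n. F n x) \<and> (\<lambda>n. F n x) \<longlonglongrightarrow> f x"
  shows "incseq (\<lambda>n. restr N (F n))" "(\<lambda>n. restr N (F n)) \<longlonglongrightarrow> restr N f"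
proof -
  have "norm_P3 N"
    using ri by (simp add: ri_quasi_Banach_function_norm_def quasi_Banach_function_norm_def)
  then have "incseq (\<lambda>n. restr N (F n)) \<and> (\<lambda>n. restr N (F n)) \<longlonglongrightarrow> restr N f"
    unfolding norm_P3_def Mplus_def
    by (rule allE[of _ F]; elim allE[of _ f] mp) (use assms in blast)
  then show "incseq (\<lambda>n. restr N (F n))" "(\<lambda>n. restr N (F n)) \<longlonglongrightarrow> restr N f"
    by auto
qed

lemma indicator_finite:
  "E \<in> sets leb \<Longrightarrow> emeasure leb E < top \<Longrightarrow> restr N (indicator E) < top"
  using ri by (simp add: ri_quasi_Banach_function_norm_def quasi_Banach_function_norm_def
      norm_P4_def)

lemma restr_star:
  assumes [measurable]: "f \<in> borel_measurable leb"
  shows "restr N (star f) = restr N f"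
proof -
  have "star (star f) = star f"
    by (rule star_cong_distrib) simp
  then have "\<forall>t\<ge>0. rearr (emb (star f)) t = rearr (emb f) t"
    by simp
  moreover have "emb (star f) \<in> Mfun" "emb f \<in> Mfun"
    by (rule emb_in_Mfun; simp add: Mplus_def)+
  moreover have "rearrangement_invariant N"
    using ri by (simp add: ri_quasi_Banach_function_norm_def)
  ultimately show ?thesis
    unfolding restr_def rearrangement_invariant_def by fast
qed

text \<open>Passing to rearrangements changes neither norm, and rearrangements are ordered pointwise
  when the distribution functions are.\<close>

lemma mono_distrib:
  assumes "f \<in> borel_measurable leb" "g \<in> borel_measurable leb"
    and "\<And>s. distrib f s \<le> distrib g s"
  shows "restr N f \<le> restr N g"
proof -
  have "restr N (star f) \<le> restr N (star g)"
    by (rule mono_everywhere[OF star_measurable[OF assms(1)] star_measurable[OF assms(2)]])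
       (rule star_mono[OF assms])
  then show ?thesis by (simp add: restr_star assms)
qed

section \<open>Norms of heads, tails and peaks, and the value of the rearrangement at 1\<close>

lemma head_le: "f \<in> borel_measurable leb \<Longrightarrow> restr N (head f) \<le> restr N f"
  by (rule mono_distrib[OF head_measurable _ distrib_head_le])

lemma tail_le: "f \<in> borel_measurable leb \<Longrightarrow> restr N (tail f) \<le> restr N f"
  by (rule mono_distrib[OF tail_measurable _ distrib_tail_le_distrib])

lemma peak_le: "f \<in> borel_measurable leb \<Longrightarrow> restr N (peak f) \<le> restr N (head f)"
  by (rule mono_distrib[OF peak_measurable head_measurable distrib_peak_le_head])

lemma indicator_Icc_finite: "restr N (indicator {0..1}) < top"
proof -
  have "{0..1::real} \<in> sets leb"
    by (simp add: sets_restrict_space_iff)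
  then show ?thesis
    by (rule indicator_finite) (simp add: emeasure_leb)
qed

lemma indicator_Icc_pos: "0 < restr N (indicator {0..1})"
proof -
  have "\<not> (AE x in leb. (indicator {0..1} x :: ennreal) = 0)"
  proof
    assume *: "AE x in leb. (indicator {0..1} x :: ennreal) = 0"
    have "distrib (indicator {0..1}) 0 \<le> distrib (\<lambda>x. 0) 0"
      using * by (intro distrib_mono_AE) (auto elim!: eventually_mono)
    moreover have "distrib (indicator {0..1}) 0 = emeasure leb {0..1}"
      unfolding distrib_def by (rule arg_cong[where f = "emeasure leb"]) (auto simp: indicator_def)
    ultimately show False
      by (simp add: emeasure_leb) (simp add: distrib_def)
  qed
  then have "restr N (indicator {0..1}) \<noteq> 0"
    by (subst eq_0_iff) auto
  then show ?thesis
    by (simp add: zero_less_iff_neq_zero)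
qed

text \<open>(Q1) allows only real factors. An infinite factor is the limit of the factors
  \<open>n\<close>, to which (P3) applies; it occurs because \<open>star f 1\<close> may be
  infinite.\<close>

lemma cmult:
  assumes [measurable]: "f \<in> borel_measurable leb"
  shows "restr N (\<lambda>x. c * f x) = c * restr N f"
proof (cases c)
  case (real r)
  then show ?thesis by (simp add: cmult_real)
next
  case top
  have lim: "(\<lambda>n. ennreal (real n) * y) \<longlonglongrightarrow> top * y" for y
  \<comment> \<open>Multiplication in \<open>ennreal\<close> is not continuous at
    \<open>top * 0 = 0\<close>, so this case is treated apart.\<close>
  proof (cases "y = 0")
    case False
    have "(\<lambda>n. of_nat n :: ennreal) \<longlonglongrightarrow> top"
      by (rule of_nat_tendsto_top_ennreal)
    then show ?thesis
      using False
      by (intro tendsto_mult_ennreal) (auto simp: ennreal_of_nat_eq_real_of_nat)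
  qed simp
  have "(\<lambda>n. restr N (\<lambda>x. ennreal (real n) * f x)) \<longlonglongrightarrow> restr N (\<lambda>x. top * f x)"
    by (rule monotone_convergence)
       (auto simp: lim incseq_def intro!: AE_I2 mult_right_mono ennreal_leI)
  then have "(\<lambda>n. ennreal (real n) * restr N f) \<longlonglongrightarrow> restr N (\<lambda>x. top * f x)"
    by (simp add: cmult_real)
  then show ?thesis
    using top LIMSEQ_unique lim by blast
qed

text \<open>On \<open>[0,1]\<close> the non-increasing \<open>star f\<close> is at least
  \<open>star f 1\<close>.\<close>

lemma star_1_le:
  assumes [measurable]: "f \<in> borel_measurable leb"
  shows "star f 1 * restr N (indicator {0..1}) \<le> restr N (head f)"
proof -
  have "star f 1 * restr N (indicator {0..1}) = restr N (\<lambda>x. star f 1 * indicator {0..1} x)"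
    by (rule cmult[symmetric]) measurable
  also have "\<dots> \<le> restr N (head f)"
    by (rule mono_everywhere) (auto simp: head_def star_antimono split: split_indicator)
  finally show ?thesis .
qed

text \<open>The norm of the indicator of \<open>[0,1]\<close> is positive and finite, so its
  reciprocal serves as \<open>c\<close>. This lets one norm absorb values at 1 that arise in
  estimates for another.\<close>

lemma star_1_bound:
  obtains c where "c < top"
    "\<And>f :: real \<Rightarrow> ennreal. f \<in> borel_measurable leb \<Longrightarrow> star f 1 \<le> c * restr N (head f)"
proof
  let ?a = "restr N (indicator {0..1})"
  show "1 / ?a < top"
    using indicator_Icc_pos by (simp add: ennreal_divide_eq_top_iff less_top[symmetric])
  fix f :: "real \<Rightarrow> ennreal" assume "f \<in> borel_measurable leb"
  then have "star f 1 * ?a / ?a \<le> restr N (head f) / ?a"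
    by (intro divide_right_mono_ennreal star_1_le)
  moreover have "star f 1 * ?a / ?a = star f 1"
    using indicator_Icc_pos indicator_Icc_finite
    by (intro ennreal_mult_divide_eq) auto
  ultimately show "star f 1 \<le> 1 / ?a * restr N (head f)"
    by (simp add: ennreal_times_divide mult.commute)
qed

text \<open>
  The sum is at most \<open>peak f + peak g + f\<^sup>*(1) + g\<^sup>*(1)\<close>, and adding a constant to a function
  shifts its rearrangement by that constant.
\<close>

lemma head_triangle:
  obtains K where "K < top"
    "\<And>f g :: real \<Rightarrow> ennreal. f \<in> borel_measurable leb \<Longrightarrow> g \<in> borel_measurable leb \<Longrightarrow>
      restr N (head (\<lambda>x. f x + g x)) \<le> K * (restr N (head f) + restr N (head g))"
proof -
  obtain C where C: "C < top"
    and tri: "\<And>f g :: real \<Rightarrow> ennreal. f \<in> borel_measurable leb \<Longrightarrow> g \<in> borel_measurable leb \<Longrightarrow>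
      restr N (\<lambda>x. f x + g x) \<le> C * (restr N f + restr N g)"
    using triangle by blast
  show thesis
  \<comment> \<open>The outer \<open>C\<close> splits off the constant, the inner one separates the
    two peaks, and the 1 pays for the constant through \<open>star_1_le\<close>.\<close>
  proof (rule that[of "C * (C + 1)"])
    show "C * (C + 1) < top"
      using C by (simp add: ennreal_mult_less_top)
    fix f g :: "real \<Rightarrow> ennreal" assume [measurable]: "f \<in> borel_measurable leb" "g \<in> borel_measurable leb"
    let ?p = "\<lambda>x. peak f x + peak g x"
    let ?c = "star f 1 + star g 1"
    let ?S = "restr N (head f) + restr N (head g)"
    have le: "f x + g x \<le> ?p x + ?c" for x
    proof -
      have "f x + g x \<le> (peak f x + star f 1) + (peak g x + star g 1)"
        by (rule add_mono; simp add: peak_def not_less)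
      then show ?thesis by (simp add: ac_simps)
    qed
    \<comment> \<open>The constant is added only on \<open>[0,1]\<close>, where the head lives; a
      constant on the whole half-line may have infinite norm.\<close>
    have "restr N (head (\<lambda>x. f x + g x)) \<le> restr N (\<lambda>t. star ?p t + ?c * indicator {0..1} t)"
    proof (rule mono_everywhere)
      fix t
      have "star (\<lambda>x. f x + g x) t \<le> star (\<lambda>x. ?p x + ?c) t"
      proof (rule star_mono)
        show "distrib (\<lambda>x. f x + g x) s \<le> distrib (\<lambda>x. ?p x + ?c) s" for s
        proof (rule distrib_mono_AE)
          show "AE x in leb. f x + g x \<le> ?p x + ?c"
            using le by blast
        qed measurable
      qed measurable
      also have "\<dots> \<le> star ?p t + ?c"
        by (rule star_add_const_le) measurable
      finally show "head (\<lambda>x. f x + g x) t \<le> star ?p t + ?c * indicator {0..1} t"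
        by (auto simp: head_def split: split_indicator)
    qed measurable
    also have "\<dots> \<le> C * (restr N (star ?p) + restr N (\<lambda>t. ?c * indicator {0..1} t))"
      by (rule tri) measurable
    also have "restr N (star ?p) = restr N ?p"
      by (rule restr_star) measurable
    also have "restr N (\<lambda>t. ?c * indicator {0..1} t) = ?c * restr N (indicator {0..1})"
      by (rule cmult) measurable
    also have "C * (restr N ?p + ?c * restr N (indicator {0..1})) \<le> C * (C * ?S + ?S)"
    proof (intro mult_left_mono add_mono)
      have "restr N ?p \<le> C * (restr N (peak f) + restr N (peak g))"
        by (rule tri) measurable
      also have "\<dots> \<le> C * ?S"
        by (intro mult_left_mono add_mono peak_le) auto
      finally show "restr N ?p \<le> C * ?S" .
      show "?c * restr N (indicator {0..1}) \<le> ?S"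
        unfolding distrib_right by (intro add_mono star_1_le) auto
    qed auto
    also have "\<dots> = C * (C + 1) * ?S"
      by (simp add: algebra_simps)
    finally show "restr N (head (\<lambda>x. f x + g x)) \<le> C * (C + 1) * ?S" .
  qed
qed

text \<open>The truncation is equimeasurable with \<open>min (star f t) (star f 1)\<close>, which is
  at most \<open>star f 1\<close> on \<open>[0,1]\<close> and at most \<open>tail f\<close>
  beyond.\<close>

lemma truncation_le:
  obtains K where "K < top"
    "\<And>f :: real \<Rightarrow> ennreal. f \<in> borel_measurable leb \<Longrightarrow>
      restr N (\<lambda>x. min (f x) (star f 1)) \<le> K * (star f 1 + restr N (tail f))"
proof -
  obtain C where C: "C < top"
    and tri: "\<And>f g :: real \<Rightarrow> ennreal. f \<in> borel_measurable leb \<Longrightarrow> g \<in> borel_measurable leb \<Longrightarrow>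
      restr N (\<lambda>x. f x + g x) \<le> C * (restr N f + restr N g)"
    using triangle by blast
  let ?b = "restr N (indicator {0..1})"
  show thesis
  proof (rule that[of "C * (?b + 1)"])
    show "C * (?b + 1) < top"
      using C indicator_Icc_finite by (simp add: ennreal_mult_less_top)
    fix f :: "real \<Rightarrow> ennreal" assume [measurable]: "f \<in> borel_measurable leb"
    let ?c = "star f 1"
    have "restr N (\<lambda>x. min (f x) ?c) \<le> restr N (\<lambda>t. min (star f t) ?c)"
      by (rule mono_distrib) (auto simp: distrib_min)
    also have "\<dots> \<le> restr N (\<lambda>t. ?c * indicator {0..1} t + tail f t)"
      by (rule mono_everywhere) (auto simp: tail_def split: split_indicator)
    also have "\<dots> \<le> C * (restr N (\<lambda>t. ?c * indicator {0..1} t) + restr N (tail f))"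
      by (rule tri) measurable
    also have "restr N (\<lambda>t. ?c * indicator {0..1} t) = ?c * ?b"
      by (rule cmult) measurable
    also have "C * (?c * ?b + restr N (tail f)) \<le> C * ((?b + 1) * (?c + restr N (tail f)))"
      by (intro mult_left_mono) (auto simp: algebra_simps intro: add_increasing2)
    finally show "restr N (\<lambda>x. min (f x) ?c) \<le> C * (?b + 1) * (?c + restr N (tail f))"
      by (simp add: mult.assoc)
  qed
qed

text \<open>
  Off a set of measure at most \<open>2\<close> the sum equals \<open>min f (f\<^sup>*(1)) + min g (g\<^sup>*(1))\<close>, so this
  function controls the rearrangement of the sum beyond \<open>2\<close>.
\<close>

lemma tail_triangle:
  obtains K where "K < top"
    "\<And>f g :: real \<Rightarrow> ennreal. f \<in> borel_measurable leb \<Longrightarrow> g \<in> borel_measurable leb \<Longrightarrow>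
      restr N (tail (\<lambda>x. f x + g x)) \<le>
        K * (star (\<lambda>x. f x + g x) 1 + (star f 1 + star g 1) + (restr N (tail f) + restr N (tail g)))"
proof -
  obtain C where C: "C < top"
    and tri: "\<And>f g :: real \<Rightarrow> ennreal. f \<in> borel_measurable leb \<Longrightarrow> g \<in> borel_measurable leb \<Longrightarrow>
      restr N (\<lambda>x. f x + g x) \<le> C * (restr N f + restr N g)"
    using triangle by blast
  obtain K where K: "K < top"
    and trunc: "\<And>f :: real \<Rightarrow> ennreal. f \<in> borel_measurable leb \<Longrightarrow>
      restr N (\<lambda>x. min (f x) (star f 1)) \<le> K * (star f 1 + restr N (tail f))"
    using truncation_le by blast
  \<comment> \<open>The tail is cut at 2, the measure lost in \<open>distrib_add_le\<close>; on
    \<open>(1,2]\<close> the rearrangement of the sum is at most its value at 1.\<close>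
  let ?I = "indicator {1<..2} :: real \<Rightarrow> ennreal"
  let ?b = "restr N ?I"
  have "{1<..2::real} \<in> sets leb"
    by (auto simp: sets_restrict_space_iff)
  then have b: "?b < top"
    by (rule indicator_finite) (simp add: emeasure_leb subset_eq)
  show thesis
  proof (rule that[of "C * (?b + C * K)"])
    show "C * (?b + C * K) < top"
      using C K b by (simp add: ennreal_mult_less_top)
    fix f g :: "real \<Rightarrow> ennreal" assume [measurable]: "f \<in> borel_measurable leb" "g \<in> borel_measurable leb"
    let ?h = "\<lambda>x. f x + g x"
    let ?k = "\<lambda>x. min (f x) (star f 1) + min (g x) (star g 1)"
    let ?far = "\<lambda>t. star ?h t * indicator {2<..} t"
    let ?S = "star f 1 + star g 1 + (restr N (tail f) + restr N (tail g))"
    have "restr N (tail ?h) \<le> restr N (\<lambda>t. star ?h 1 * ?I t + ?far t)"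
      by (rule mono_everywhere) (auto simp: tail_def star_antimono split: split_indicator)
    also have "\<dots> \<le> C * (restr N (\<lambda>t. star ?h 1 * ?I t) + restr N ?far)"
      by (rule tri) measurable
    also have "restr N (\<lambda>t. star ?h 1 * ?I t) = star ?h 1 * ?b"
      by (rule cmult) measurable
    also have "C * (star ?h 1 * ?b + restr N ?far) \<le> C * (star ?h 1 * ?b + C * K * ?S)"
    proof (intro mult_left_mono add_left_mono)
      have "restr N ?far \<le> restr N ?k"
      proof (rule mono_distrib)
        fix s
        \<comment> \<open>Discarding \<open>[0,2]\<close> lowers the bound for the superlevel set by
          2, which offsets the 2 in \<open>distrib_add_le\<close>.\<close>
        have "distrib ?far s \<le> distrib ?h s - ennreal 2"
          by (rule distrib_tail_le) auto
        also have "\<dots> \<le> distrib ?k s"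
          using distrib_add_le[of f g s] by (simp add: ennreal_minus_le_iff)
        finally show "distrib ?far s \<le> distrib ?k s" .
      qed measurable
      also have "\<dots> \<le> C * (restr N (\<lambda>x. min (f x) (star f 1)) + restr N (\<lambda>x. min (g x) (star g 1)))"
        by (rule tri) measurable
      also have "\<dots> \<le> C * (K * (star f 1 + restr N (tail f)) + K * (star g 1 + restr N (tail g)))"
        by (intro mult_left_mono add_mono trunc) auto
      also have "\<dots> = C * K * ?S"
        by (simp add: algebra_simps)
      finally show "restr N ?far \<le> C * K * ?S" .
    qed auto
    also have "\<dots> \<le> C * ((?b + C * K) * (star ?h 1 + ?S))"
      by (intro mult_left_mono) (auto simp: distrib_left distrib_right mult.commute
          intro!: add_mono add_increasing add_increasing2)
    finally show "restr N (tail ?h) \<le> C * (?b + C * K) *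
        (star ?h 1 + (star f 1 + star g 1) + (restr N (tail f) + restr N (tail g)))"
      by (simp add: ac_simps)
  qed
qed

end

text \<open>Integration of the pointwise bound \<open>f \<le> peak f + star f 1\<close> over
  \<open>E\<close>.\<close>

lemma nn_integral_le_peak:
  assumes [measurable]: "f \<in> borel_measurable leb" "E \<in> sets leb"
  shows "(\<integral>\<^sup>+x\<in>E. f x \<partial>leb) \<le> (\<integral>\<^sup>+x\<in>E. peak f x \<partial>leb) + star f 1 * emeasure leb E"
proof -
  have "(\<integral>\<^sup>+x\<in>E. f x \<partial>leb) \<le> (\<integral>\<^sup>+x. peak f x * indicator E x + star f 1 * indicator E x \<partial>leb)"
    by (rule nn_integral_mono) (auto simp: peak_def not_less split: split_indicator)
  also have "\<dots> = (\<integral>\<^sup>+x\<in>E. peak f x \<partial>leb) + (\<integral>\<^sup>+x. star f 1 * indicator E x \<partial>leb)"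
    by (rule nn_integral_add) measurable
  also have "(\<integral>\<^sup>+x. star f 1 * indicator E x \<partial>leb) = star f 1 * emeasure leb E"
    by (rule nn_integral_cmult_indicator) measurable
  finally show ?thesis .
qed

section \<open>Wiener--Luxemburg amalgams\<close>

locale WL_pair = A: ri_norm A + B: ri_norm B for A B :: fnorm
begin

section \<open>The axioms for the Wiener--Luxemburg quasinorm\<close>

lemma WL_norm_eq:
  "WL_norm A B f = restr A (head (\<lambda>x. emod (f x))) + restr B (tail (\<lambda>x. emod (f x)))"
  by (simp add: WL_norm_def restr_def head_def[abs_def] tail_def[abs_def] rearr_eq_star)

lemma restr_WL: "restr (WL_norm A B) f = restr A (head f) + restr B (tail f)"
  by (simp add: restr_def[of "WL_norm A B"] WL_norm_eq emb_def)

lemma emod_measurable: "f \<in> Mfun \<Longrightarrow> (\<lambda>x. emod (f x)) \<in> borel_measurable leb"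
  unfolding Mfun_def by (rule measurable_compose[OF _ measurable_emod])

lemma WL_AE_cong:
  assumes "f \<in> Mfun" "g \<in> Mfun" "AE x in leb. f x = g x"
  shows "WL_norm A B f = WL_norm A B g"
proof -
  have "star (\<lambda>x. emod (f x)) = star (\<lambda>x. emod (g x))"
  proof (intro star_cong_distrib antisym distrib_mono_AE emod_measurable assms(1,2))
    show "AE x in leb. emod (f x) \<le> emod (g x)" "AE x in leb. emod (g x) \<le> emod (f x)"
      using assms(3) by (eventually_elim; simp)+
  qed
  then show ?thesis by (simp add: WL_norm_def rearr_eq_star)
qed

lemma WL_mono:
  assumes "f \<in> borel_measurable leb" "g \<in> borel_measurable leb" "AE x in leb. f x \<le> g x"
  shows "restr (WL_norm A B) f \<le> restr (WL_norm A B) g"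
proof -
  have "star f t \<le> star g t" for t
    by (intro star_mono distrib_mono_AE assms)
  then show ?thesis
    unfolding restr_WL using assms
    by (intro add_mono A.mono_everywhere B.mono_everywhere head_measurable tail_measurable)
       (auto simp: head_def tail_def split: split_indicator)
qed

lemma WL_cmult:
  assumes [measurable]: "f \<in> borel_measurable leb" and "0 \<le> c"
  shows "restr (WL_norm A B) (\<lambda>x. ennreal c * f x) = ennreal c * restr (WL_norm A B) f"
proof -
  have "head (\<lambda>x. ennreal c * f x) = (\<lambda>t. ennreal c * head f t)"
    "tail (\<lambda>x. ennreal c * f x) = (\<lambda>t. ennreal c * tail f t)"
    using assms by (simp_all add: fun_eq_iff head_def tail_def star_cmult mult.assoc)
  then show ?thesis
    by (simp add: restr_WL A.cmult B.cmult distrib_left)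
qed

text \<open>For the implication from left to right the head in \<open>A\<close> suffices: if its
  norm is 0, then \<open>star f 1 = 0\<close>, so the peak is \<open>f\<close> itself, and the peak
  vanishes almost everywhere because its norm is at most that of the head.\<close>

lemma WL_eq_0_iff:
  assumes [measurable]: "f \<in> borel_measurable leb"
  shows "restr (WL_norm A B) f = 0 \<longleftrightarrow> (AE x in leb. f x = 0)"
proof
  assume "AE x in leb. f x = 0"
  then have "restr A f = 0" "restr B f = 0"
    by (simp_all add: A.eq_0_iff B.eq_0_iff)
  then show "restr (WL_norm A B) f = 0"
    using A.head_le[OF assms] B.tail_le[OF assms] by (simp add: restr_WL)
next
  assume "restr (WL_norm A B) f = 0"
  then have "restr A (peak f) = 0" "restr A (head f) = 0"
    using A.peak_le[OF assms] by (simp_all add: restr_WL)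
  moreover obtain c where "star f 1 \<le> c * restr A (head f)"
    using A.star_1_bound assms by blast
  ultimately have "AE x in leb. peak f x = 0" "star f 1 = 0"
    using A.eq_0_iff[of "peak f"] by auto
  then show "AE x in leb. f x = 0"
    by (auto elim!: eventually_mono simp: peak_def split: if_splits)
qed

text \<open>The tail estimate in \<open>B\<close> produces values of rearrangements at 1. By
  \<open>star_1_bound\<close> they are controlled by \<open>A\<close>-norms of heads, for the sum
  itself after the head estimate.\<close>

lemma WL_triangle:
  obtains K where "K < top"
    "\<And>f g :: real \<Rightarrow> ennreal. f \<in> borel_measurable leb \<Longrightarrow> g \<in> borel_measurable leb \<Longrightarrow>
      restr (WL_norm A B) (\<lambda>x. f x + g x) \<le> K * (restr (WL_norm A B) f + restr (WL_norm A B) g)"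
proof -
  obtain P where P: "P < top"
    and head: "\<And>f g :: real \<Rightarrow> ennreal. f \<in> borel_measurable leb \<Longrightarrow> g \<in> borel_measurable leb \<Longrightarrow>
      restr A (head (\<lambda>x. f x + g x)) \<le> P * (restr A (head f) + restr A (head g))"
    using A.head_triangle by blast
  obtain Q where Q: "Q < top"
    and tail: "\<And>f g :: real \<Rightarrow> ennreal. f \<in> borel_measurable leb \<Longrightarrow> g \<in> borel_measurable leb \<Longrightarrow>
      restr B (tail (\<lambda>x. f x + g x)) \<le>
        Q * (star (\<lambda>x. f x + g x) 1 + (star f 1 + star g 1) + (restr B (tail f) + restr B (tail g)))"
    using B.tail_triangle by blast
  obtain c where c: "c < top"
    and star_1: "\<And>f :: real \<Rightarrow> ennreal. f \<in> borel_measurable leb \<Longrightarrow> star f 1 \<le> c * restr A (head f)"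
    using A.star_1_bound by blast
  show thesis
  \<comment> \<open>\<open>P\<close> is for the heads; \<open>c * P\<close> comes from the value at
    1 for the sum, \<open>c\<close> from those for \<open>f\<close> and \<open>g\<close>, and 1 from
    the tails.\<close>
  proof (rule that[of "P + Q * (c * P + c + 1)"])
    show "P + Q * (c * P + c + 1) < top"
      using P Q c by (simp add: ennreal_mult_less_top)
    fix f g :: "real \<Rightarrow> ennreal"
    assume [measurable]: "f \<in> borel_measurable leb" "g \<in> borel_measurable leb"
    let ?h = "\<lambda>x. f x + g x"
    define x y where "x = restr A (head f) + restr A (head g)"
      and "y = restr B (tail f) + restr B (tail g)"
    have h: "restr A (head ?h) \<le> P * x"
      unfolding x_def by (rule head) measurable
    have s: "star ?h 1 \<le> c * (P * x)"
      by (rule order_trans[OF star_1 mult_left_mono[OF h]]) auto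
    have s': "star f 1 + star g 1 \<le> c * x"
      unfolding x_def distrib_left by (intro add_mono star_1) measurable
    have "restr B (tail ?h) \<le> Q * (star ?h 1 + (star f 1 + star g 1) + y)"
      unfolding y_def by (rule tail) measurable
    also have "\<dots> \<le> Q * (c * (P * x) + c * x + y)"
      by (intro mult_left_mono add_mono s s') auto
    finally have "restr A (head ?h) + restr B (tail ?h) \<le> P * x + Q * (c * (P * x) + c * x + y)"
      by (intro add_mono h)
    also have "\<dots> \<le> P * (x + y) + Q * (c * P * (x + y) + c * (x + y) + (x + y))"
      by (intro add_mono mult_left_mono) (auto simp: mult.assoc intro!: mult_left_mono)
    also have "\<dots> = (P + Q * (c * P + c + 1)) * (x + y)"
      by (simp add: algebra_simps)
    finally show "restr (WL_norm A B) ?h \<le>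
        (P + Q * (c * P + c + 1)) * (restr (WL_norm A B) f + restr (WL_norm A B) g)"
      by (simp add: restr_WL x_def y_def ac_simps)
  qed
qed

lemma WL_Q1: "norm_Q1 (WL_norm A B)"
proof -
  obtain K where K: "K < top" and tri:
    "\<And>f g :: real \<Rightarrow> ennreal. f \<in> borel_measurable leb \<Longrightarrow> g \<in> borel_measurable leb \<Longrightarrow>
      restr (WL_norm A B) (\<lambda>x. f x + g x) \<le> K * (restr (WL_norm A B) f + restr (WL_norm A B) g)"
    using WL_triangle by blast
  \<comment> \<open>\<open>norm_Q1\<close> asks for a real constant that is at least 1, hence the
    maximum.\<close>
  have le: "K \<le> ennreal (max 1 (enn2real K))"
    using K by (cases K) (auto intro: ennreal_leI)
  have "restr (WL_norm A B) (\<lambda>x. f x + g x) \<le>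
      ennreal (max 1 (enn2real K)) * (restr (WL_norm A B) f + restr (WL_norm A B) g)"
    if "f \<in> borel_measurable leb" "g \<in> borel_measurable leb" for f g
    by (rule order_trans[OF tri[OF that] mult_right_mono[OF le]]) simp
  then have "\<exists>C\<ge>1. \<forall>f\<in>Mplus. \<forall>g\<in>Mplus. restr (WL_norm A B) (\<lambda>x. f x + g x) \<le>
      ennreal C * (restr (WL_norm A B) f + restr (WL_norm A B) g)"
    by (intro exI[of _ "max 1 (enn2real K)"]) (auto simp: Mplus_def)
  then show ?thesis
    unfolding norm_Q1_def by (auto simp: Mplus_def WL_cmult WL_eq_0_iff)
qed

text \<open>Since \<open>star_SUP\<close> holds at every \<open>t\<close>, heads and tails increase
  to their limits everywhere, and (P3) for \<open>A\<close> and for \<open>B\<close>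
  applies.\<close>

lemma WL_monotone_convergence:
  assumes [measurable]: "\<And>n. F n \<in> borel_measurable leb" "f \<in> borel_measurable leb"
    and conv: "AE x in leb. incseq (\<lambda>n. F n x) \<and> (\<lambda>n. F n x) \<longlonglongrightarrow> f x"
  shows "incseq (\<lambda>n. restr (WL_norm A B) (F n)) \<and>
    (\<lambda>n. restr (WL_norm A B) (F n)) \<longlonglongrightarrow> restr (WL_norm A B) f"
proof -
  note S = star_SUP[OF assms]
  have "incseq (\<lambda>n. head (F n) t) \<and> (\<lambda>n. head (F n) t) \<longlonglongrightarrow> head f t"
    "incseq (\<lambda>n. tail (F n) t) \<and> (\<lambda>n. tail (F n) t) \<longlonglongrightarrow> tail f t" for t
    using S[of t] by (auto simp: head_def tail_def incseq_def split: split_indicator)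
  then have ae: "AE t in leb. incseq (\<lambda>n. head (F n) t) \<and> (\<lambda>n. head (F n) t) \<longlonglongrightarrow> head f t"
    "AE t in leb. incseq (\<lambda>n. tail (F n) t) \<and> (\<lambda>n. tail (F n) t) \<longlonglongrightarrow> tail f t"
    by simp_all
  have "incseq (\<lambda>n. restr A (head (F n)))" "(\<lambda>n. restr A (head (F n))) \<longlonglongrightarrow> restr A (head f)"
    using A.monotone_convergence[OF _ _ ae(1)] by simp_all
  moreover have "incseq (\<lambda>n. restr B (tail (F n)))" "(\<lambda>n. restr B (tail (F n))) \<longlonglongrightarrow> restr B (tail f)"
    using B.monotone_convergence[OF _ _ ae(2)] by simp_all
  ultimately show ?thesis
    by (auto simp: restr_WL incseq_def intro: tendsto_add add_mono)
qed

lemma ri_quasi_Banach_function_norm_WL: "ri_quasi_Banach_function_norm (WL_norm A B)"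
  unfolding ri_quasi_Banach_function_norm_def quasi_Banach_function_norm_def
proof (intro conjI)
  show "\<forall>f\<in>Mfun. \<forall>g\<in>Mfun. (AE x in leb. f x = g x) \<longrightarrow> WL_norm A B f = WL_norm A B g"
    using WL_AE_cong by blast
  show "\<forall>f\<in>Mfun. WL_norm A B (emb (\<lambda>x. emod (f x))) = WL_norm A B f"
    by (simp add: WL_norm_eq emb_def)
  show "norm_Q1 (WL_norm A B)"
    by (rule WL_Q1)
  show "norm_P2 (WL_norm A B)"
    unfolding norm_P2_def Mplus_def using WL_mono by blast
  show "norm_P3 (WL_norm A B)"
    unfolding norm_P3_def Mplus_def by (intro allI impI WL_monotone_convergence) simp_all
  show "norm_P4 (WL_norm A B)"
    unfolding norm_P4_def
  proof (intro ballI impI)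
    fix E :: "real set" assume [measurable]: "E \<in> sets leb" and E: "emeasure leb E < \<infinity>"
    have m: "(indicator E :: real \<Rightarrow> ennreal) \<in> borel_measurable leb"
      by measurable
    have "restr A (indicator E) < top" "restr B (indicator E) < top"
      using E by (auto intro: A.indicator_finite B.indicator_finite)
    then show "restr (WL_norm A B) (indicator E) < \<infinity>"
      using A.head_le[OF m] B.tail_le[OF m] by (auto simp: restr_WL intro: le_less_trans)
  qed
  show "rearrangement_invariant (WL_norm A B)"
    unfolding rearrangement_invariant_def
  proof (intro ballI impI)
    fix f g assume "\<forall>t\<ge>0. rearr f t = rearr g t"
    \<comment> \<open>The rearrangements are known to agree only for \<open>t \<ge> 0\<close>, but
      both indicators vanish at negative \<open>t\<close>.\<close>
    then have "(\<lambda>t. rearr f t * indicator {0..1} t) = (\<lambda>t. rearr g t * indicator {0..1} t)"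
      "(\<lambda>t. rearr f t * indicator {1<..} t) = (\<lambda>t. rearr g t * indicator {1<..} t)"
      by (auto simp: fun_eq_iff split: split_indicator)
    then show "WL_norm A B f = WL_norm A B g"
      by (simp add: WL_norm_def)
  qed
qed

text \<open>
  Both directions integrate \<open>f\<close> as \<open>peak f\<close> plus the constant \<open>f\<^sup>*(1)\<close>; since \<open>peak f\<close> is supported
  on a set of measure at most \<open>1\<close>, its two norms agree.
\<close>

lemma P5_WL_iff: "norm_P5 (WL_norm A B) \<longleftrightarrow> norm_P5 A"
proof -
  obtain c where c: "c < top"
    and star_1: "\<And>f :: real \<Rightarrow> ennreal. f \<in> borel_measurable leb \<Longrightarrow> star f 1 \<le> c * restr A (head f)"
    using A.star_1_bound by blast
  \<comment> \<open>One argument serves both implications: (P5) passes from \<open>M\<close> to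
    \<open>N\<close> as soon as the \<open>N\<close>-norm of \<open>f\<close> bounds the
    \<open>M\<close>-norm of its peak and the \<open>A\<close>-norm of its head.\<close>
  have "\<exists>K<\<infinity>. \<forall>f\<in>Mplus. (\<integral>\<^sup>+x\<in>E. f x \<partial>leb) \<le> K * restr N f"
    if E: "E \<in> sets leb" "emeasure leb E < \<infinity>"
      and "norm_P5 M"
      and peak: "\<And>f. f \<in> borel_measurable leb \<Longrightarrow> restr M (peak f) \<le> restr N f"
      and head: "\<And>f. f \<in> borel_measurable leb \<Longrightarrow> restr A (head f) \<le> restr N f"
    for E M N
  proof -
    obtain K :: ennreal where K: "K < \<infinity>"
      and int: "\<And>f. f \<in> borel_measurable leb \<Longrightarrow> (\<integral>\<^sup>+x\<in>E. f x \<partial>leb) \<le> K * restr M f"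
      using \<open>norm_P5 M\<close> E unfolding norm_P5_def Mplus_def by blast
    \<comment> \<open>\<open>K\<close> pays for the integral of the peak,
      \<open>c * emeasure leb E\<close> for that of the constant \<open>star f 1\<close>.\<close>
    have "(\<integral>\<^sup>+x\<in>E. f x \<partial>leb) \<le> (K + c * emeasure leb E) * restr N f"
      if f: "f \<in> borel_measurable leb" for f
    proof -
      have "(\<integral>\<^sup>+x\<in>E. f x \<partial>leb) \<le> (\<integral>\<^sup>+x\<in>E. peak f x \<partial>leb) + star f 1 * emeasure leb E"
        by (rule nn_integral_le_peak[OF f E(1)])
      also have "\<dots> \<le> K * restr N f + c * restr N f * emeasure leb E"
      proof (intro add_mono mult_right_mono)
        show "(\<integral>\<^sup>+x\<in>E. peak f x \<partial>leb) \<le> K * restr N f"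
          by (rule order_trans[OF int[OF peak_measurable[OF f]] mult_left_mono[OF peak[OF f]]]) simp
        show "star f 1 \<le> c * restr N f"
          by (rule order_trans[OF star_1[OF f] mult_left_mono[OF head[OF f]]]) simp
      qed simp
      finally show ?thesis by (simp add: algebra_simps)
    qed
    moreover have "K + c * emeasure leb E < \<infinity>"
      using K c E by (simp add: ennreal_mult_less_top)
    ultimately show ?thesis
      unfolding Mplus_def by blast
  qed
  note transfer = this
  have WL_peak: "restr (WL_norm A B) (peak f) \<le> restr A f" if f: "f \<in> borel_measurable leb" for f
  proof -
    \<comment> \<open>The rearrangement of the peak vanishes beyond 1, so \<open>B\<close>
      contributes nothing.\<close>
    have "tail (peak f) = (\<lambda>_. 0)"
      using distrib_peak_le[OF f] by (intro tail_eq_0 peak_measurable f) auto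
    moreover have "restr B (\<lambda>_. 0) = 0"
      by (simp add: B.eq_0_iff)
    ultimately have "restr (WL_norm A B) (peak f) = restr A (head (peak f))"
      by (simp add: restr_WL)
    also have "\<dots> \<le> restr A (peak f)"
      by (rule A.head_le[OF peak_measurable[OF f]])
    also have "\<dots> \<le> restr A f"
      by (rule order_trans[OF A.peak_le[OF f] A.head_le[OF f]])
    finally show ?thesis .
  qed
  have head_WL: "restr A (head f) \<le> restr (WL_norm A B) f" for f
    by (simp add: restr_WL)
  show ?thesis
  proof
    assume "norm_P5 (WL_norm A B)"
    then show "norm_P5 A"
      unfolding norm_P5_def[of A]
      by (intro ballI impI transfer[of _ "WL_norm A B"] WL_peak A.head_le)
  next
    assume "norm_P5 A"
    then show "norm_P5 (WL_norm A B)"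
      unfolding norm_P5_def[of "WL_norm A B"]
      by (intro ballI impI transfer[of _ A] order_trans[OF A.peak_le head_WL] head_WL)
  qed
qed

end

theorem theorem5p3:
  fixes A B :: fnorm
  assumes "ri_quasi_Banach_function_norm A"
    and "ri_quasi_Banach_function_norm B"
  shows "ri_quasi_Banach_function_norm (WL_norm A B) \<and>
    ri_quasi_Banach_function_space (WL A B) \<and>
    (norm_P5 (WL_norm A B) \<longleftrightarrow> norm_P5 A)"
proof -
  interpret WL_pair A B
    using assms by unfold_locales
  have "WL A B = fun_space (WL_norm A B)"
    by (simp add: WL_def fun_space_def)
  then show ?thesis
    using ri_quasi_Banach_function_norm_WL P5_WL_iff
    unfolding ri_quasi_Banach_function_space_def by blast
qed

end
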